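(* Let $(X,d)$ be a Busemann space and let $\omega\colon\mathbb{R}\to X$ be a geodesic. (1) Let $X_\omega$ be the union of the images of all geodesics $\gamma\colon\mathbb{R}\to X$ parallel to $\omega$. Then $X_\omega$ is a convex subspace of $X$. (2) Let $\mathbb{X}_\omega(\mathbb{R})$ be the set of the images $\gamma(\mathbb{R})$ of all geodesics $\gamma\colon\mathbb{R}\to X$ parallel to $\omega$, equipped with the Hausdorff metric. Then $\mathbb{X}_\omega(\mathbb{R})$ is a Busemann space. (3) $X_\omega$ (with the subspace topology from $X$) is homeomorphic to the product $\mathbb{X}_\omega(\mathbb{R})\times\mathbb{R}$.
   Context: Let $(X,d)$ be a metric space. A map $\gamma\colon I\to X$ on a closed interval $I\subset\mathbb{R}$ (possibly $I=\mathbb{R}$) is a geodesic if $d(\gamma(s),\gamma(t))=|t-s|$ for all $s,t\in I$. $X$ is a geodesic space if any two points are joined by a geodesic. A linearly reparametrised geodesic is a map of the form $t\mapsto\gamma(\lambda t)$ with $\gamma$ a geodesic and $\lambda>0$. A geodesic space is a Busemann space if for any two linearly reparametrised geodesics $\gamma,\eta\colon[0,1]\to X$ the function $t\mapsto d(\gamma(t),\eta(t))$ is convex on $[0,1]$. A Busemann space is uniquely geodesic. A subset of a Busemann space is convex if it contains the geodesic between any two of its points. Two geodesics $\gamma,\eta\colon\mathbb{R}\to X$ are parallel if $d(\gamma(t),\eta(t))$ is bounded in $t\in\mathbb{R}$. *)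

theory Defs
  imports "HOL-Analysis.Analysis"
begin

definition geodesic :: "'a set \<Rightarrow> ('a \<Rightarrow> 'a \<Rightarrow> real) \<Rightarrow> real set \<Rightarrow> (real \<Rightarrow> 'a) \<Rightarrow> bool" where
  "geodesic X d I \<gamma> \<longleftrightarrow>
     is_interval I \<and> closed I \<and> I \<noteq> {} \<and> \<gamma> ` I \<subseteq> X \<and>
     (\<forall>s\<in>I. \<forall>t\<in>I. d (\<gamma> s) (\<gamma> t) = \<bar>t - s\<bar>)"

definition geodesic_space :: "'a set \<Rightarrow> ('a \<Rightarrow> 'a \<Rightarrow> real) \<Rightarrow> bool" where
  "geodesic_space X d \<longleftrightarrow>
     Metric_space X d \<and>
     (\<forall>x\<in>X. \<forall>y\<in>X. \<exists>a b \<gamma>. a \<le> b \<and> geodesic X d {a..b} \<gamma> \<and> \<gamma> a = x \<and> \<gamma> b = y)"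

text \<open>
  If \<open>t \<mapsto> \<gamma> (l * t)\<close> has domain \<open>I\<close>, then \<open>\<gamma>\<close> has domain \<open>(*) l ` I\<close>.
\<close>
definition lin_rep_geodesic :: "'a set \<Rightarrow> ('a \<Rightarrow> 'a \<Rightarrow> real) \<Rightarrow> real set \<Rightarrow> (real \<Rightarrow> 'a) \<Rightarrow> bool" where
  "lin_rep_geodesic X d I \<sigma> \<longleftrightarrow>
     (\<exists>l>0. \<exists>\<gamma>. geodesic X d ((*) l ` I) \<gamma> \<and> (\<forall>t\<in>I. \<sigma> t = \<gamma> (l * t)))"

definition Busemann_space :: "'a set \<Rightarrow> ('a \<Rightarrow> 'a \<Rightarrow> real) \<Rightarrow> bool" where
  "Busemann_space X d \<longleftrightarrow>
     geodesic_space X d \<and>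
     (\<forall>\<gamma> \<eta>. lin_rep_geodesic X d {0..1} \<gamma> \<longrightarrow> lin_rep_geodesic X d {0..1} \<eta> \<longrightarrow>
        convex_on {0..1} (\<lambda>t. d (\<gamma> t) (\<eta> t)))"

text \<open>
  Intended for Busemann spaces, where the geodesic between two points exists and is
  unique up to translation of its domain.
\<close>
definition geodesically_convex :: "'a set \<Rightarrow> ('a \<Rightarrow> 'a \<Rightarrow> real) \<Rightarrow> 'a set \<Rightarrow> bool" where
  "geodesically_convex X d S \<longleftrightarrow>
     S \<subseteq> X \<and>
     (\<forall>a b \<gamma>. a \<le> b \<longrightarrow> geodesic X d {a..b} \<gamma> \<longrightarrow> \<gamma> a \<in> S \<longrightarrow> \<gamma> b \<in> S \<longrightarrow> \<gamma> ` {a..b} \<subseteq> S)"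

definition parallel :: "('a \<Rightarrow> 'a \<Rightarrow> real) \<Rightarrow> (real \<Rightarrow> 'a) \<Rightarrow> (real \<Rightarrow> 'a) \<Rightarrow> bool" where
  "parallel d \<gamma> \<eta> \<longleftrightarrow> bounded (range (\<lambda>t. d (\<gamma> t) (\<eta> t)))"

definition parallel_lines :: "'a set \<Rightarrow> ('a \<Rightarrow> 'a \<Rightarrow> real) \<Rightarrow> (real \<Rightarrow> 'a) \<Rightarrow> 'a set set" where
  "parallel_lines X d \<omega> = {range \<gamma> |\<gamma>. geodesic X d UNIV \<gamma> \<and> parallel d \<gamma> \<omega>}"

definition parallel_set :: "'a set \<Rightarrow> ('a \<Rightarrow> 'a \<Rightarrow> real) \<Rightarrow> (real \<Rightarrow> 'a) \<Rightarrow> 'a set" where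
  "parallel_set X d \<omega> = \<Union> (parallel_lines X d \<omega>)"

text \<open>
  The supremum and infima are taken in \<open>[0, \<infinity>]\<close>, so that the result is nonnegative and
  symmetric for arbitrary sets, as the locale \<open>Metric_space\<close> requires also outside the carrier.
  An infinite distance is sent to 0. This cannot make a family of sets a metric space by
  accident: distinct sets at infinite distance would violate the axiom that distinct points
  have nonzero distance.
\<close>
definition hausdorff_dist :: "('a \<Rightarrow> 'a \<Rightarrow> real) \<Rightarrow> 'a set \<Rightarrow> 'a set \<Rightarrow> real" where
  "hausdorff_dist d A B =
     enn2real (max (SUP a\<in>A. INF b\<in>B. ennreal (d a b)) (SUP b\<in>B. INF a\<in>A. ennreal (d b a)))"

end

theory Submission
  imports Defs
begin

text \<open>
  Let \<open>\<gamma>\<close> and \<open>\<eta>\<close> be parallel geodesic lines. A bounded convex function on the real line is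
  constant, so \<open>d (\<gamma> s) (\<eta> t) = N (t - s)\<close> for a convex function \<open>N\<close>. The points \<open>m t\<close> dividing
  the segments from \<open>\<gamma> t\<close> to \<open>\<eta> t\<close> in a fixed ratio again form a parallel line: convexity gives
  \<open>d (m s) (m t) \<le> \<bar>t - s\<bar>\<close>, and a strict inequality would make the path from \<open>\<gamma> (- T)\<close> via
  \<open>m s\<close> and \<open>m t\<close> to \<open>\<eta> T\<close> shorter than \<open>N (2 * T)\<close> for large \<open>T\<close>. This yields (1).
  Two applications of convexity show moreover that the line \<open>m\<close> does not change when \<open>\<eta>\<close> is
  reparametrised by a shift. Since the Hausdorff distance of \<open>\<gamma>\<close> and \<open>\<eta>\<close> is the minimum of
  \<open>N\<close>, attained from every point of \<open>\<gamma>\<close>, the convexity inequality for lines reduces to that of \<open>X\<close>,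
  which is (2). For (3), a point is mapped to the line through it and to its value under the
  Busemann function of \<open>\<omega>\<close>, which restricts to an isometric coordinate on every line; this map is
  bi-Lipschitz.
\<close>

section \<open>Points dividing a segment in a given ratio\<close>

text \<open>Phrased by distances alone, so that it serves both for \<open>X\<close> and for the
  space of lines and needs no parametrisation of a geodesic.\<close>

definition segment_point :: "'a set \<Rightarrow> ('a \<Rightarrow> 'a \<Rightarrow> real) \<Rightarrow> real \<Rightarrow> 'a \<Rightarrow> 'a \<Rightarrow> 'a \<Rightarrow> bool" where
  "segment_point X d v x y z \<longleftrightarrow> z \<in> X \<and> d x z = v * d x y \<and> d z y = (1 - v) * d x y"

lemma geodesic_in: "geodesic X d I \<gamma> \<Longrightarrow> t \<in> I \<Longrightarrow> \<gamma> t \<in> X"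
  by (auto simp: geodesic_def)

lemma geodesic_dist: "geodesic X d I \<gamma> \<Longrightarrow> s \<in> I \<Longrightarrow> t \<in> I \<Longrightarrow> d (\<gamma> s) (\<gamma> t) = \<bar>t - s\<bar>"
  by (auto simp: geodesic_def)

lemma geodesic_segment_point:
  assumes g: "geodesic X d I \<gamma>" and s: "s \<in> I" and t: "t \<in> I" and v: "0 \<le> v" "v \<le> 1"
  shows "segment_point X d v (\<gamma> s) (\<gamma> t) (\<gamma> ((1 - v) * s + v * t))"
proof -
  have "convex I"
    using g by (simp add: geodesic_def is_interval_convex_1)
  then have r: "(1 - v) * s + v * t \<in> I"
    using convexD_alt[of I s t v] s t v by simp
  have e: "(1 - v) * s + v * t - s = v * (t - s)" "t - ((1 - v) * s + v * t) = (1 - v) * (t - s)"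
    by (auto simp: algebra_simps)
  show ?thesis
    unfolding segment_point_def
    using geodesic_in[OF g r] geodesic_dist[OF g s r] geodesic_dist[OF g r t] geodesic_dist[OF g s t] v
    by (simp add: e abs_mult)
qed

lemma lin_rep_geodesic_segment_point:
  assumes g: "lin_rep_geodesic X d {0..1} \<sigma>" and s: "s \<in> {0..1}" and t: "t \<in> {0..1}"
    and v: "0 \<le> v" "v \<le> 1"
  shows "segment_point X d v (\<sigma> s) (\<sigma> t) (\<sigma> ((1 - v) * s + v * t))"
proof -
  obtain l \<gamma> where l: "l > 0" and \<gamma>: "geodesic X d ((*) l ` {0..1}) \<gamma>"
    and \<sigma>: "\<And>t. t \<in> {0..1} \<Longrightarrow> \<sigma> t = \<gamma> (l * t)"
    using g unfolding lin_rep_geodesic_def by blast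
  have r: "(1 - v) * s + v * t \<in> {0..1}"
    using convexD_alt[of "{0..1}" s t v] s t v by simp
  have "l * ((1 - v) * s + v * t) = (1 - v) * (l * s) + v * (l * t)"
    by (simp add: algebra_simps)
  moreover have "segment_point X d v (\<gamma> (l * s)) (\<gamma> (l * t)) (\<gamma> ((1 - v) * (l * s) + v * (l * t)))"
    using geodesic_segment_point[OF \<gamma>] s t v by blast
  ultimately show ?thesis
    by (simp only: \<sigma>[OF s] \<sigma>[OF t] \<sigma>[OF r])
qed

lemma lin_rep_geodesic_in:
  "lin_rep_geodesic X d I \<sigma> \<Longrightarrow> t \<in> I \<Longrightarrow> \<sigma> t \<in> X"
  unfolding lin_rep_geodesic_def using geodesic_in by fastforce

text \<open>Reduces the Busemann property to single division points: on any subinterval of its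
  domain a linearly reparametrised geodesic passes through the division points of its two
  values.\<close>

lemma Busemann_spaceI:
  assumes "geodesic_space X d"
    and le: "\<And>v x y z x' y' z'. \<lbrakk>0 \<le> v; v \<le> 1; x \<in> X; y \<in> X; x' \<in> X; y' \<in> X;
      segment_point X d v x y z; segment_point X d v x' y' z'\<rbrakk>
      \<Longrightarrow> d z z' \<le> (1 - v) * d x x' + v * d y y'"
  shows "Busemann_space X d"
  unfolding Busemann_space_def
proof (intro conjI allI impI)
  fix \<gamma> \<eta> assume g: "lin_rep_geodesic X d {0..1} \<gamma>" and h: "lin_rep_geodesic X d {0..1} \<eta>"
  show "convex_on {0..1} (\<lambda>t. d (\<gamma> t) (\<eta> t))"
  proof (rule convex_onI)
    fix v s t :: real assume v: "0 < v" "v < 1" and s: "s \<in> {0..1}" and t: "t \<in> {0..1}"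
    show "d (\<gamma> ((1 - v) *\<^sub>R s + v *\<^sub>R t)) (\<eta> ((1 - v) *\<^sub>R s + v *\<^sub>R t))
        \<le> (1 - v) * d (\<gamma> s) (\<eta> s) + v * d (\<gamma> t) (\<eta> t)"
      unfolding real_scaleR_def
      by (rule le) (use v s t g h in \<open>auto intro: lin_rep_geodesic_segment_point lin_rep_geodesic_in\<close>)
  qed simp
qed fact

section \<open>Convexity of the distance between division points\<close>

locale busemann = Metric_space X d for X :: "'a set" and d +
  assumes busemann: "Busemann_space X d"
begin

abbreviation "segpt \<equiv> segment_point X d"

lemma segpt_in: "segpt v x y z \<Longrightarrow> z \<in> X"
  by (simp add: segment_point_def)

lemma ex_geodesic:
  assumes "x \<in> X" "y \<in> X"
  obtains \<sigma> where "geodesic X d {0..d x y} \<sigma>" "\<sigma> 0 = x" "\<sigma> (d x y) = y"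
proof -
  obtain a b \<gamma> where ab: "a \<le> b" and g: "geodesic X d {a..b} \<gamma>" and e: "\<gamma> a = x" "\<gamma> b = y"
    using busemann assms unfolding Busemann_space_def geodesic_space_def by blast
  have D: "d x y = b - a"
    using geodesic_dist[OF g, of a b] ab e by simp
  have "geodesic X d {0..d x y} (\<lambda>t. \<gamma> (a + t))"
    unfolding geodesic_def
  proof (intro conjI ballI)
    show "(\<lambda>t. \<gamma> (a + t)) ` {0..d x y} \<subseteq> X"
      using geodesic_in[OF g] D by auto
    show "d (\<gamma> (a + s)) (\<gamma> (a + t)) = \<bar>t - s\<bar>" if "s \<in> {0..d x y}" "t \<in> {0..d x y}" for s t
      using geodesic_dist[OF g, of "a + s" "a + t"] that D by simp
  qed (auto simp: is_interval_cc)
  then show ?thesis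
    using that[of "\<lambda>t. \<gamma> (a + t)"] D e by simp
qed

lemma ex_segpt:
  assumes "x \<in> X" "y \<in> X" "0 \<le> v" "v \<le> 1"
  obtains z where "segpt v x y z"
proof -
  obtain \<sigma> where "geodesic X d {0..d x y} \<sigma>" "\<sigma> 0 = x" "\<sigma> (d x y) = y"
    using ex_geodesic assms by blast
  then show ?thesis
    using geodesic_segment_point[of X d "{0..d x y}" \<sigma> 0 "d x y" v] assms that by auto
qed

text \<open>Geodesics from \<open>x\<close> to \<open>z\<close> and from \<open>z\<close> to
  \<open>y\<close> fit together to a geodesic, since their lengths add up to \<open>d x y\<close>.
  The scaling factor is \<open>d x y\<close>, which must be positive.\<close>

lemma segpt_lin_rep_geodesic:
  assumes x: "x \<in> X" and y: "y \<in> X" and v: "0 \<le> v" "v \<le> 1" and z: "segpt v x y z" and "x \<noteq> y"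
  obtains \<sigma> where "lin_rep_geodesic X d {0..1} \<sigma>" "\<sigma> 0 = x" "\<sigma> 1 = y" "\<sigma> v = z"
proof -
  define D where "D = d x y"
  have D: "D > 0"
    using assms unfolding D_def by simp
  have zX: "z \<in> X" and xz: "d x z = v * D" and zy: "d z y = (1 - v) * D"
    using z by (auto simp: segment_point_def D_def)
  obtain p where p: "geodesic X d {0..d x z} p" "p 0 = x" "p (d x z) = z"
    using ex_geodesic x zX by blast
  obtain q where q: "geodesic X d {0..d z y} q" "q 0 = z" "q (d z y) = y"
    using ex_geodesic y zX by blast
  define g where "g t = (if t \<le> v * D then p t else q (t - v * D))" for t
  have vD: "0 \<le> v * D" "v * D \<le> D"
    using v D by (auto simp: mult_left_le_one_le)
  have gp: "g t = p t" if "t \<le> v * D" for t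
    using that by (simp add: g_def)
  have gq: "g t = q (t - v * D)" if "t \<ge> v * D" for t
    using that p(3) q(2) by (cases "t = v * D") (simp_all add: g_def xz)
  have gX: "g t \<in> X" if "t \<in> {0..D}" for t
    using geodesic_in[OF p(1)] geodesic_in[OF q(1)] that xz zy
    by (auto simp: g_def algebra_simps)
  have le: "d (g s) (g t) = t - s" if st: "0 \<le> s" "s \<le> t" "t \<le> D" for s t
  proof -
    consider "t \<le> v * D" | "v * D \<le> s" | "s \<le> v * D" "v * D \<le> t"
      by linarith
    then show ?thesis
    proof cases
      case 1
      then show ?thesis
        using geodesic_dist[OF p(1), of s t] st xz by (simp add: gp)
    next
      case 2
      then show ?thesis
        using geodesic_dist[OF q(1), of "s - v * D" "t - v * D"] st zy
        by (simp add: gq left_diff_distrib)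
    next
      case 3
      have ps: "d x (g s) = s" "d (g s) z = v * D - s"
        using geodesic_dist[OF p(1), of 0 s] geodesic_dist[OF p(1), of s "v * D"] p st 3 xz
        by (auto simp: gp)
      have qt: "d (g t) y = D - t" "d z (g t) = t - v * D"
        using geodesic_dist[OF q(1), of 0 "t - v * D"]
          geodesic_dist[OF q(1), of "t - v * D" "d z y"] q st 3 zy
        by (auto simp: gq algebra_simps)
      have "d (g s) (g t) \<le> t - s"
        using triangle[of "g s" z "g t"] gX[of s] gX[of t] zX st ps qt by simp
      \<comment> \<open>The path through \<open>x\<close>, \<open>g s\<close>, \<open>g t\<close>,
        \<open>y\<close> cannot be shorter than \<open>D\<close>, so no piece can be shorter than
        its parameter length.\<close>
      moreover have "D \<le> s + d (g s) (g t) + (D - t)"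
        using triangle[of x "g s" y] triangle[of "g s" "g t" y] gX[of s] gX[of t] x y st ps qt
        by (simp add: D_def)
      ultimately show ?thesis
        by simp
    qed
  qed
  have "geodesic X d {0..D} g"
    unfolding geodesic_def
  proof (intro conjI ballI)
    show "d (g s) (g t) = \<bar>t - s\<bar>" if "s \<in> {0..D}" "t \<in> {0..D}" for s t
      using le[of s t] le[of t s] that commute[of "g s" "g t"] by (cases "s \<le> t") auto
  qed (use gX D in \<open>auto simp: is_interval_cc\<close>)
  moreover have "(*) D ` {0..1} = {0..D}"
    using D by (simp add: image_mult_atLeastAtMost)
  ultimately have "lin_rep_geodesic X d {0..1} (\<lambda>t. g (D * t))"
    unfolding lin_rep_geodesic_def using D by (intro exI[of _ D]) auto
  moreover have "g (D * v) = z" "g (D * 0) = x" "g (D * 1) = y"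
    using gp[of "v * D"] gp[of 0] gq[of D] p q vD xz zy by (simp_all add: algebra_simps)
  ultimately show ?thesis
    using that[of "\<lambda>t. g (D * t)"] by simp
qed

lemma segpt_dist_le_nondegenerate:
  assumes "x \<in> X" "y \<in> X" "x' \<in> X" "y' \<in> X" and v: "0 \<le> v" "v \<le> 1"
    and "segpt v x y z" "segpt v x' y' z'" and "x \<noteq> y" "x' \<noteq> y'"
  shows "d z z' \<le> (1 - v) * d x x' + v * d y y'"
proof -
  obtain \<sigma> where \<sigma>: "lin_rep_geodesic X d {0..1} \<sigma>" "\<sigma> 0 = x" "\<sigma> 1 = y" "\<sigma> v = z"
    using segpt_lin_rep_geodesic assms by metis
  obtain \<tau> where \<tau>: "lin_rep_geodesic X d {0..1} \<tau>" "\<tau> 0 = x'" "\<tau> 1 = y'" "\<tau> v = z'"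
    using segpt_lin_rep_geodesic assms by metis
  have "convex_on {0..1} (\<lambda>t. d (\<sigma> t) (\<tau> t))"
    using busemann \<sigma> \<tau> unfolding Busemann_space_def by blast
  from convex_onD[OF this, of v 0 1] show ?thesis
    using \<sigma> \<tau> v by simp
qed

text \<open>
  Constant maps are not linearly reparametrised geodesics (\<open>\<lambda> > 0\<close>), so a degenerate
  segment is approximated by short nondegenerate ones.
\<close>
lemma segpt_dist_le_degenerate:
  assumes p: "p \<in> X" and xy: "x \<in> X" "y \<in> X" and v: "0 \<le> v" "v \<le> 1"
    and z: "segpt v x y z" and "x \<noteq> y"
  shows "d p z \<le> (1 - v) * d p x + v * d p y"
proof (rule field_le_epsilon)
  fix e :: real assume e: "0 < e"
  obtain q where q: "q \<in> X" "q \<noteq> p"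
    using xy \<open>x \<noteq> y\<close> by metis
  \<comment> \<open>This ratio places \<open>r\<close> on the segment from \<open>p\<close> to
    \<open>q\<close>, different from \<open>p\<close> but within \<open>e / 2\<close> of it;
    \<open>r\<close> then replaces one endpoint of the constant segment at \<open>p\<close>.\<close>
  define u where "u = min 1 (e / (2 * d p q))"
  have "0 < d p q"
    using p q by auto
  then have u: "0 < u" "u \<le> 1" "u * d p q \<le> e / 2"
    using e by (auto simp: u_def min_def field_simps)
  obtain r where r: "segpt u p q r"
    using ex_segpt[of p q u] p q u by auto
  have rX: "r \<in> X" and pr: "d p r \<le> e / 2" and "d p r > 0"
    using r u \<open>0 < d p q\<close> by (auto simp: segment_point_def)
  then have "p \<noteq> r"
    using p by auto
  obtain w where w: "segpt v p r w"
    using ex_segpt p rX v by blast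
  have "d w z \<le> (1 - v) * d p x + v * d r y"
    by (rule segpt_dist_le_nondegenerate[OF p rX xy v w z \<open>p \<noteq> r\<close> \<open>x \<noteq> y\<close>])
  moreover have "d r y \<le> e / 2 + d p y"
    using triangle[OF rX p xy(2)] pr commute[of r p] by simp
  then have "v * d r y \<le> v * (e / 2 + d p y)"
    using v by (simp add: mult_left_mono)
  moreover have "v * (e / 2) \<le> e / 2"
    using v e by (simp add: mult_left_le_one_le)
  moreover have "d p w \<le> e / 2"
    using w v pr mult_left_le_one_le[of "d p r" v] by (simp add: segment_point_def)
  moreover have "d p z \<le> d p w + d w z"
    using triangle[OF p segpt_in[OF w] segpt_in[OF z]] .
  ultimately show "d p z \<le> (1 - v) * d p x + v * d p y + e"
    unfolding distrib_left by linarith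
qed

lemma segpt_refl: "x \<in> X \<Longrightarrow> segpt v x x z \<longleftrightarrow> z = x"
  by (auto simp: segment_point_def)

lemma segpt_dist_le:
  assumes X: "x \<in> X" "y \<in> X" "x' \<in> X" "y' \<in> X" and v: "0 \<le> v" "v \<le> 1"
    and z: "segpt v x y z" "segpt v x' y' z'"
  shows "d z z' \<le> (1 - v) * d x x' + v * d y y'"
proof -
  consider "x = y" "x' = y'" | "x = y" "x' \<noteq> y'" | "x \<noteq> y" "x' = y'" | "x \<noteq> y" "x' \<noteq> y'"
    by blast
  then show ?thesis
  proof cases
    case 1
    then show ?thesis
      using z X by (simp add: segpt_refl left_diff_distrib)
  next
    case 2
    then show ?thesis
      using z X v segpt_dist_le_degenerate[of x x' y' v z'] by (simp add: segpt_refl)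
  next
    case 3
    then show ?thesis
      using z X v segpt_dist_le_degenerate[of x' x y v z] by (simp add: segpt_refl commute)
  next
    case 4
    then show ?thesis
      using segpt_dist_le_nondegenerate assms by blast
  qed
qed

text \<open>Convexity is applied to two copies of the same segment, whose endpoints have distance
  0.\<close>

lemma segpt_unique:
  assumes "x \<in> X" "y \<in> X" "0 \<le> v" "v \<le> 1" "segpt v x y z" "segpt v x y z'"
  shows "z = z'"
proof -
  have "d z z' = 0"
    using segpt_dist_le[of x y x y v z z'] assms nonneg[of z z'] by simp
  then show ?thesis
    using assms segpt_in by auto
qed

text \<open>The two upper bounds add up to \<open>d x y\<close>, so the triangle inequality turns
  both into equalities.\<close>

lemma segptI:
  assumes X: "x \<in> X" "y \<in> X" "z \<in> X"
    and "d x z \<le> v * d x y" "d z y \<le> (1 - v) * d x y"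
  shows "segpt v x y z"
  using triangle[of x z y] assms unfolding segment_point_def
  by (simp add: algebra_simps)


section \<open>Parallel geodesic lines and their distance function\<close>

abbreviation "line \<equiv> geodesic X d UNIV"

lemma line_in: "line \<gamma> \<Longrightarrow> \<gamma> t \<in> X"
  by (simp add: geodesic_in)

lemma line_dist: "line \<gamma> \<Longrightarrow> d (\<gamma> s) (\<gamma> t) = \<bar>t - s\<bar>"
  by (simp add: geodesic_dist)

lemma line_shift: "line \<gamma> \<Longrightarrow> line (\<lambda>t. \<gamma> (t + a))"
  unfolding geodesic_def by (auto simp: algebra_simps)

lemma lineI:
  assumes "\<And>t. \<gamma> t \<in> X" and "\<And>s t. s \<le> t \<Longrightarrow> d (\<gamma> s) (\<gamma> t) = t - s"
  shows "line \<gamma>"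
  unfolding geodesic_def
proof (intro conjI ballI)
  show "d (\<gamma> s) (\<gamma> t) = \<bar>t - s\<bar>" for s t
    using assms(2)[of s t] assms(2)[of t s] commute[of "\<gamma> s" "\<gamma> t"] by (cases "s \<le> t") auto
qed (use assms(1) in auto)

lemma parallelI: "(\<And>t. d (\<gamma> t) (\<eta> t) \<le> K) \<Longrightarrow> parallel d \<gamma> \<eta>"
  unfolding parallel_def by (intro boundedI[of _ K]) auto

lemma parallelE:
  assumes "parallel d \<gamma> \<eta>"
  obtains K where "\<And>t. d (\<gamma> t) (\<eta> t) \<le> K"
proof -
  obtain K where "\<bar>d (\<gamma> t) (\<eta> t)\<bar> \<le> K" for t
    using assms unfolding parallel_def bounded_iff by auto
  then show ?thesis
    using that[of K] by simp
qed

lemma parallel_sym: "parallel d \<gamma> \<eta> \<Longrightarrow> parallel d \<eta> \<gamma>"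
  by (simp add: parallel_def commute)

lemma parallel_trans:
  assumes "line \<gamma>" "line \<eta>" "line \<theta>" "parallel d \<gamma> \<eta>" "parallel d \<eta> \<theta>"
  shows "parallel d \<gamma> \<theta>"
proof -
  obtain K L where "\<And>t. d (\<gamma> t) (\<eta> t) \<le> K" "\<And>t. d (\<eta> t) (\<theta> t) \<le> L"
    using assms parallelE by metis
  then have "d (\<gamma> t) (\<theta> t) \<le> K + L" for t
    using triangle[of "\<gamma> t" "\<eta> t" "\<theta> t"] assms(1-3) line_in by (smt (verit))
  then show ?thesis
    by (rule parallelI)
qed

lemma parallel_shift:
  assumes "line \<gamma>" "line \<eta>" "parallel d \<gamma> \<eta>"
  shows "parallel d (\<lambda>t. \<gamma> (t + a)) \<eta>"
proof -
  have "parallel d (\<lambda>t. \<gamma> (t + a)) \<gamma>"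
    using assms line_dist by (intro parallelI[of _ _ "\<bar>a\<bar>"]) auto
  then show ?thesis
    using parallel_trans line_shift assms by blast
qed

text \<open>The distance is a bounded convex function of the parameter. As \<open>a\<close> and
  \<open>b\<close> are arbitrary, this one inequality already makes it constant.\<close>

lemma parallel_dist_le:
  assumes \<gamma>: "line \<gamma>" and \<eta>: "line \<eta>" and par: "parallel d \<gamma> \<eta>"
  shows "d (\<gamma> b) (\<eta> b) \<le> d (\<gamma> a) (\<eta> a)"
proof -
  define f where "f t = d (\<gamma> t) (\<eta> t)" for t
  obtain K where K: "\<And>t. f t \<le> K"
    using parallelE[OF par] unfolding f_def by blast
  have cvx: "f ((1 - v) * s + v * t) \<le> (1 - v) * f s + v * f t" if "0 \<le> v" "v \<le> 1" for v s t
    unfolding f_def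
    using segpt_dist_le[OF _ _ _ _ that geodesic_segment_point[OF \<gamma> _ _ that]
        geodesic_segment_point[OF \<eta> _ _ that]] line_in \<gamma> \<eta> by simp
  have le: "f b \<le> f a + (K - f a) / real (Suc n)" for n
  proof -
    \<comment> \<open>\<open>b\<close> lies between \<open>a\<close> and a point
      \<open>n + 1\<close> times as far from \<open>a\<close>. The far value is bounded by
      \<open>K\<close> and has weight \<open>v\<close>, which tends to 0.\<close>
    define v where "v = 1 / real (Suc n)"
    have v: "0 < v" "v \<le> 1"
      by (simp_all add: v_def)
    have "(1 - v) * a + v * (a + (b - a) / v) = b"
      using v by (simp add: field_simps)
    then have "f b \<le> (1 - v) * f a + v * f (a + (b - a) / v)"
      using cvx[of v a "a + (b - a) / v"] v by simp
    also have "\<dots> \<le> (1 - v) * f a + v * K"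
      using K v by (simp add: mult_left_mono)
    also have "\<dots> = f a + (K - f a) * v"
      by (simp add: algebra_simps)
    also have "\<dots> = f a + (K - f a) / real (Suc n)"
      by (simp add: v_def)
    finally show ?thesis .
  qed
  have "(\<lambda>n. f a + (K - f a) / real (Suc n)) \<longlonglongrightarrow> f a + 0"
    by (intro tendsto_intros LIMSEQ_Suc lim_const_over_n)
  then have "f b \<le> f a"
    using le by (intro LIMSEQ_le_const) auto
  then show ?thesis
    by (simp add: f_def)
qed

text \<open>Shifting \<open>\<eta>\<close> by \<open>t - s\<close> keeps it parallel to
  \<open>\<gamma>\<close>; the two sides are the constant distance read off at the parameters
  \<open>s\<close> and 0.\<close>

lemma parallel_dist:
  assumes \<gamma>: "line \<gamma>" and \<eta>: "line \<eta>" and par: "parallel d \<gamma> \<eta>"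
  shows "d (\<gamma> s) (\<eta> t) = d (\<gamma> 0) (\<eta> (t - s))"
proof -
  have "parallel d \<gamma> (\<lambda>r. \<eta> (r + (t - s)))"
    using parallel_shift parallel_sym assms by blast
  then show ?thesis
    using parallel_dist_le[OF \<gamma> line_shift[OF \<eta>], of "t - s" s 0]
      parallel_dist_le[OF \<gamma> line_shift[OF \<eta>], of "t - s" 0 s] by simp
qed

section \<open>Lines of division points between parallel lines\<close>

text \<open>
  With \<open>N u = d (\<gamma> 0) (\<eta> u)\<close>, the function \<open>N u - u\<close> decreases to a finite limit \<open>b\<close>. Hence
  the upper bounds for \<open>d (\<gamma> (- T)) (m s)\<close> and \<open>d (m t) (\<eta> T)\<close> given by convexity add up to
  \<open>2 * T - (t - s) + b\<close> up to \<open>e\<close>, whereas \<open>d (\<gamma> (- T)) (\<eta> T)\<close> is at least \<open>2 * T + b\<close>.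
\<close>
lemma line_segpt:
  assumes \<gamma>: "line \<gamma>" and \<eta>: "line \<eta>" and par: "parallel d \<gamma> \<eta>"
    and v: "0 \<le> v" "v \<le> 1" and m: "\<And>t. segpt v (\<gamma> t) (\<eta> t) (m t)"
  shows "line m"
proof (rule lineI)
  show mX: "m t \<in> X" for t
    using m segpt_in by blast
  fix s t :: real assume st: "s \<le> t"
  define N where "N u = d (\<gamma> 0) (\<eta> u)" for u
  have N: "d (\<gamma> p) (\<eta> q) = N (q - p)" for p q
    using parallel_dist[OF \<gamma> \<eta> par] by (simp add: N_def)
  define b where "b = (INF u. N u - u)"
  have bdd: "bdd_below (range (\<lambda>u. N u - u))"
  proof (rule bdd_belowI2)
    fix u show "- N 0 \<le> N u - u"
      using triangle[of "\<eta> 0" "\<gamma> 0" "\<eta> u"] line_in[OF \<gamma>] line_in[OF \<eta>] line_dist[OF \<eta>, of 0 u]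
        commute[of "\<eta> 0" "\<gamma> 0"]
      by (simp add: N_def)
  qed
  have b: "b \<le> N u - u" for u
    unfolding b_def by (rule cINF_lower[OF bdd]) simp
  have anti: "N u' - u' \<le> N u - u" if "u \<le> u'" for u u'
    using triangle[of "\<gamma> 0" "\<eta> u" "\<eta> u'"] line_in[OF \<gamma>] line_in[OF \<eta>] line_dist[OF \<eta>, of u u'] that
    by (simp add: N_def)
  have "d (m s) (m t) \<le> (1 - v) * d (\<gamma> s) (\<gamma> t) + v * d (\<eta> s) (\<eta> t)"
    using segpt_dist_le m v line_in \<gamma> \<eta> by blast
  then have upper: "d (m s) (m t) \<le> t - s"
    using st by (simp add: line_dist[OF \<gamma>] line_dist[OF \<eta>] algebra_simps)
  have "t - s \<le> d (m s) (m t) + e" if e: "0 < e" for e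
  proof -
    have "\<exists>u\<in>range (\<lambda>u. N u - u). u < b + e"
      using cInf_lessD[of "range (\<lambda>u. N u - u)" "b + e"] e unfolding b_def by auto
    then obtain U where U: "N U - U < b + e"
      by auto
    \<comment> \<open>The first two bounds carry the estimate at \<open>U\<close> over to
      \<open>T + s\<close> and \<open>T - t\<close> by monotonicity; the last two make these numbers
      the distances along the lines.\<close>
    define T where "T = max (max (U - s) (U + t)) (max (- s) t)"
    have T: "U \<le> T + s" "U \<le> T - t" "0 \<le> T + s" "0 \<le> T - t"
      by (auto simp: T_def)
    \<comment> \<open>The far endpoints enter as constant segments, so convexity bounds their
      distances to \<open>m s\<close> and \<open>m t\<close>.\<close>
    have g: "segpt v (\<gamma> (- T)) (\<gamma> (- T)) (\<gamma> (- T))" "segpt v (\<eta> T) (\<eta> T) (\<eta> T)"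
      using segpt_refl line_in \<gamma> \<eta> by auto
    have "d (\<gamma> (- T)) (m s) \<le> (1 - v) * (T + s) + v * N (T + s)"
      using segpt_dist_le[OF _ _ _ _ v g(1) m[of s]] line_in \<gamma> \<eta> T
      by (simp add: line_dist[OF \<gamma>] N add.commute)
    also have "\<dots> \<le> (1 - v) * (T + s) + v * (T + s + b + e)"
      using anti[OF T(1)] U v by (intro add_left_mono mult_left_mono) auto
    finally have 1: "d (\<gamma> (- T)) (m s) \<le> T + s + v * (b + e)"
      by (simp add: algebra_simps)
    have "d (m t) (\<eta> T) \<le> (1 - v) * N (T - t) + v * (T - t)"
      using segpt_dist_le[OF _ _ _ _ v m[of t] g(2)] line_in \<gamma> \<eta> T
      by (simp add: line_dist[OF \<eta>] N)
    also have "\<dots> \<le> (1 - v) * (T - t + b + e) + v * (T - t)"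
      using anti[OF T(2)] U v by (intro add_right_mono mult_left_mono) auto
    finally have 2: "d (m t) (\<eta> T) \<le> T - t + (1 - v) * (b + e)"
      by (simp add: algebra_simps)
    have "2 * T + b \<le> N (2 * T)"
      using b[of "2 * T"] by simp
    also have "\<dots> = d (\<gamma> (- T)) (\<eta> T)"
      by (simp add: N)
    also have "\<dots> \<le> d (\<gamma> (- T)) (m s) + d (m s) (m t) + d (m t) (\<eta> T)"
      using triangle[of "\<gamma> (- T)" "m s" "\<eta> T"] triangle[of "m s" "m t" "\<eta> T"] mX line_in \<gamma> \<eta>
      by (smt (verit))
    also have "\<dots> \<le> (T + s + v * (b + e)) + d (m s) (m t) + (T - t + (1 - v) * (b + e))"
      using 1 2 by simp
    also have "\<dots> = 2 * T + s - t + b + e + d (m s) (m t)"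
      by (simp add: algebra_simps)
    finally show ?thesis
      by simp
  qed
  then show "d (m s) (m t) = t - s"
    using upper field_le_epsilon[of "t - s" "d (m s) (m t)"] by simp
qed

lemma parallel_segpt:
  assumes \<gamma>: "line \<gamma>" and \<eta>: "line \<eta>" and par: "parallel d \<gamma> \<eta>"
    and v: "0 \<le> v" "v \<le> 1" and m: "\<And>t. segpt v (\<gamma> t) (\<eta> t) (m t)"
  shows "parallel d m \<gamma>"
proof -
  obtain K where "\<And>t. d (\<gamma> t) (\<eta> t) \<le> K"
    using par parallelE by metis
  then have "d (m t) (\<gamma> t) \<le> K" for t
    using m[of t] v mult_left_le_one_le[of "d (\<gamma> t) (\<eta> t)" v] commute[of "m t" "\<gamma> t"]
    by (smt (verit) nonneg segment_point_def)
  then show ?thesis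
    by (rule parallelI)
qed

text \<open>
  Writing \<open>r = (1 - v) * s + v * t\<close>, the triangle with apex \<open>\<gamma> r\<close> bounds \<open>d (\<gamma> s) (m r)\<close>
  and the one with apex \<open>\<eta> r\<close> bounds \<open>d (m r) (\<eta> t)\<close>.
\<close>
lemma segpt_oblique:
  assumes \<gamma>: "line \<gamma>" and \<eta>: "line \<eta>" and par: "parallel d \<gamma> \<eta>"
    and v: "0 \<le> v" "v \<le> 1" and m: "\<And>t. segpt v (\<gamma> t) (\<eta> t) (m t)"
  shows "segpt v (\<gamma> s) (\<eta> t) (m ((1 - v) * s + v * t))"
proof (rule segptI)
  define r where "r = (1 - v) * s + v * t"
  \<comment> \<open>Since \<open>r - s = v * (t - s)\<close>, going from \<open>\<gamma> r\<close>
    back by \<open>t - s\<close> passes \<open>\<gamma> s\<close> at ratio \<open>v\<close>. The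
    opposite side then has the same parameter difference \<open>t - s\<close> as
    \<open>\<gamma> s\<close> and \<open>\<eta> t\<close>, hence the same length.\<close>
  have "segpt v (\<gamma> r) (\<gamma> (r - (t - s))) (\<gamma> s)"
    using geodesic_segment_point[OF \<gamma>, of r "r - (t - s)" v] v
    by (simp add: r_def algebra_simps)
  then have "d (\<gamma> s) (m r) \<le> v * d (\<gamma> (r - (t - s))) (\<eta> r)"
    using segpt_dist_le[OF _ _ _ _ v _ m[of r]] line_in \<gamma> \<eta> by fastforce
  also have "d (\<gamma> (r - (t - s))) (\<eta> r) = d (\<gamma> s) (\<eta> t)"
    by (simp add: parallel_dist[OF \<gamma> \<eta> par, of "r - (t - s)"] parallel_dist[OF \<gamma> \<eta> par, of s])
  finally show "d (\<gamma> s) (m ((1 - v) * s + v * t)) \<le> v * d (\<gamma> s) (\<eta> t)"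
    by (simp add: r_def)
  have "segpt v (\<eta> (r + (t - s))) (\<eta> r) (\<eta> t)"
    using geodesic_segment_point[OF \<eta>, of "r + (t - s)" r v] v
    by (simp add: r_def algebra_simps)
  then have "d (m r) (\<eta> t) \<le> (1 - v) * d (\<gamma> r) (\<eta> (r + (t - s)))"
    using segpt_dist_le[OF _ _ _ _ v m[of r]] line_in \<gamma> \<eta> by fastforce
  also have "d (\<gamma> r) (\<eta> (r + (t - s))) = d (\<gamma> s) (\<eta> t)"
    by (simp add: parallel_dist[OF \<gamma> \<eta> par, of r] parallel_dist[OF \<gamma> \<eta> par, of s])
  finally show "d (m ((1 - v) * s + v * t)) (\<eta> t) \<le> (1 - v) * d (\<gamma> s) (\<eta> t)"
    by (simp add: r_def)
qed (use line_in \<gamma> \<eta> segpt_in[OF m] in auto)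

text \<open>One shift \<open>u\<close> works for every \<open>s\<close> because the distance depends
  only on the difference of parameters. As a function of it, the distance is 1-Lipschitz and grows
  at infinity, so a compact interval contains a minimum.\<close>

lemma parallel_dist_attains_inf:
  assumes \<gamma>: "line \<gamma>" and \<eta>: "line \<eta>" and par: "parallel d \<gamma> \<eta>"
  obtains u where "\<And>s t. d (\<gamma> s) (\<eta> (s + u)) \<le> d (\<gamma> s) (\<eta> t)"
proof -
  define N where "N u = d (\<gamma> 0) (\<eta> u)" for u
  have N: "d (\<gamma> p) (\<eta> q) = N (q - p)" for p q
    using parallel_dist[OF \<gamma> \<eta> par] by (simp add: N_def)
  have lip: "\<bar>N p - N q\<bar> \<le> \<bar>p - q\<bar>" for p q
    using triangle[of "\<gamma> 0" "\<eta> p" "\<eta> q"] triangle[of "\<gamma> 0" "\<eta> q" "\<eta> p"]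
      line_in[OF \<gamma>] line_in[OF \<eta>] line_dist[OF \<eta>, of p q] line_dist[OF \<eta>, of q p]
    by (simp add: N_def)
  have "continuous_on UNIV N"
  proof (intro continuous_at_imp_continuous_on ballI)
    fix x show "isCont N x"
      unfolding continuous_at_eps_delta dist_real_def using lip by (meson le_less_trans)
  qed
  then have "continuous_on {- 2 * N 0..2 * N 0} N"
    using continuous_on_subset by blast
  moreover have "{- 2 * N 0..2 * N 0} \<noteq> {}"
    by (simp add: N_def)
  ultimately obtain u where u: "u \<in> {- 2 * N 0..2 * N 0}" "\<forall>w\<in>{- 2 * N 0..2 * N 0}. N u \<le> N w"
    using continuous_attains_inf[OF compact_Icc] by metis
  have "N u \<le> N w" for w
  \<comment> \<open>Outside the interval \<open>\<bar>w\<bar> > 2 * N 0\<close>, so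
    \<open>N w \<ge> \<bar>w\<bar> - N 0 > N 0 \<ge> N u\<close>.\<close>
  proof (cases "w \<in> {- 2 * N 0..2 * N 0}")
    case False
    have "\<bar>w\<bar> \<le> N 0 + N w"
      using triangle[of "\<eta> 0" "\<gamma> 0" "\<eta> w"] line_in[OF \<gamma>] line_in[OF \<eta>] line_dist[OF \<eta>, of 0 w]
        commute[of "\<eta> 0" "\<gamma> 0"]
      by (simp add: N_def)
    moreover have "N u \<le> N 0"
      using u(2) by (simp add: N_def)
    ultimately show ?thesis
      using False by auto
  qed (use u in auto)
  then show ?thesis
    using that[of u] by (simp add: N)
qed

end

section \<open>The Hausdorff metric on parallel lines\<close>

text \<open>All inner infima equal \<open>\<delta>\<close>, so both suprema run over a constant;
  nonemptiness keeps them from being 0 by default.\<close>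

lemma hausdorff_dist_eqI:
  assumes "A \<noteq> {}" "B \<noteq> {}"
    and le: "\<And>a b. a \<in> A \<Longrightarrow> b \<in> B \<Longrightarrow> \<delta> \<le> d a b" "\<And>a b. a \<in> A \<Longrightarrow> b \<in> B \<Longrightarrow> \<delta> \<le> d b a"
    and A: "\<And>a. a \<in> A \<Longrightarrow> \<exists>b\<in>B. d a b = \<delta>" and B: "\<And>b. b \<in> B \<Longrightarrow> \<exists>a\<in>A. d b a = \<delta>"
    and "0 \<le> \<delta>"
  shows "hausdorff_dist d A B = \<delta>"
proof -
  have "(INF b\<in>B. ennreal (d a b)) = ennreal \<delta>" if a: "a \<in> A" for a
  proof (rule antisym)
    obtain b where "b \<in> B" "d a b = \<delta>"
      using A[OF a] by blast
    then show "(INF b\<in>B. ennreal (d a b)) \<le> ennreal \<delta>"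
      using INF_lower[of b B "\<lambda>b. ennreal (d a b)"] by simp
    show "ennreal \<delta> \<le> (INF b\<in>B. ennreal (d a b))"
      by (rule INF_greatest) (use a le in \<open>simp add: ennreal_leI\<close>)
  qed
  moreover have "(INF a\<in>A. ennreal (d b a)) = ennreal \<delta>" if b: "b \<in> B" for b
  proof (rule antisym)
    obtain a where "a \<in> A" "d b a = \<delta>"
      using B[OF b] by blast
    then show "(INF a\<in>A. ennreal (d b a)) \<le> ennreal \<delta>"
      using INF_lower[of a A "\<lambda>a. ennreal (d b a)"] by simp
    show "ennreal \<delta> \<le> (INF a\<in>A. ennreal (d b a))"
      by (rule INF_greatest) (use b le in \<open>simp add: ennreal_leI\<close>)
  qed
  ultimately show ?thesis
    using assms(1,2) \<open>0 \<le> \<delta>\<close> by (simp add: hausdorff_dist_def)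
qed

locale busemann_line = busemann X d for X :: "'a set" and d +
  fixes \<omega> :: "real \<Rightarrow> 'a"
  assumes line_\<omega>: "line \<omega>"
begin

abbreviation "lines \<equiv> parallel_lines X d \<omega>"
abbreviation "hdist \<equiv> hausdorff_dist d"

lemma linesE:
  assumes "A \<in> lines" "x \<in> A"
  obtains \<gamma> where "line \<gamma>" "parallel d \<gamma> \<omega>" "A = range \<gamma>" "x = \<gamma> 0"
proof -
  obtain \<gamma> where \<gamma>: "A = range \<gamma>" "line \<gamma>" "parallel d \<gamma> \<omega>"
    using assms(1) by (auto simp: parallel_lines_def)
  then obtain a where a: "x = \<gamma> a"
    using assms(2) by auto
  have "A = range (\<lambda>t. \<gamma> (t + a))"
    using \<gamma>(1) image_image[of \<gamma> "\<lambda>t. t + a" UNIV] surj_plus_right[of a] by simp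
  then show ?thesis
    using that[of "\<lambda>t. \<gamma> (t + a)"] line_shift[OF \<gamma>(2)] parallel_shift[OF \<gamma>(2) line_\<omega> \<gamma>(3)] a by simp
qed

lemma lines_in: "A \<in> lines \<Longrightarrow> x \<in> A \<Longrightarrow> x \<in> X"
  using linesE line_in by metis

lemma lines_nonempty: "A \<in> lines \<Longrightarrow> A \<noteq> {}"
  by (auto simp: parallel_lines_def)

text \<open>The minimising shift \<open>u\<close> pairs each point of \<open>A\<close> with a
  nearest point of \<open>B\<close>, and the opposite shift pairs the points of \<open>B\<close>
  with those of \<open>A\<close> at the same distance.\<close>

lemma hdist_lines:
  assumes A: "A \<in> lines" and B: "B \<in> lines"
  shows "(\<forall>x\<in>A. \<forall>y\<in>B. hdist A B \<le> d x y) \<and> (\<forall>x\<in>A. \<exists>y\<in>B. d x y = hdist A B)"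
proof -
  obtain \<gamma> where \<gamma>: "line \<gamma>" "parallel d \<gamma> \<omega>" "A = range \<gamma>"
    using A by (auto simp: parallel_lines_def)
  obtain \<eta> where \<eta>: "line \<eta>" "parallel d \<eta> \<omega>" "B = range \<eta>"
    using B by (auto simp: parallel_lines_def)
  have par: "parallel d \<gamma> \<eta>"
    using \<gamma> \<eta> line_\<omega> parallel_sym parallel_trans by blast
  obtain u where u: "\<And>s t. d (\<gamma> s) (\<eta> (s + u)) \<le> d (\<gamma> s) (\<eta> t)"
    using parallel_dist_attains_inf[OF \<gamma>(1) \<eta>(1) par] by blast
  define \<delta> where "\<delta> = d (\<gamma> 0) (\<eta> u)"
  have \<delta>: "d (\<gamma> s) (\<eta> (s + u)) = \<delta>" for s
    using parallel_dist[OF \<gamma>(1) \<eta>(1) par, of s "s + u"] by (simp add: \<delta>_def)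
  have le: "\<delta> \<le> d x y" if "x \<in> A" "y \<in> B" for x y
    using that u \<delta> by (auto simp: \<gamma> \<eta>)
  have Aex: "\<exists>y\<in>B. d x y = \<delta>" if "x \<in> A" for x
    using that \<delta> by (auto simp: \<gamma> \<eta>)
  have "\<exists>x\<in>A. d y x = \<delta>" if y: "y \<in> B" for y
  proof -
    obtain t where "y = \<eta> t"
      using y \<eta> by auto
    then show ?thesis
      using \<delta>[of "t - u"] commute by (auto simp: \<gamma>)
  qed
  then have "hdist A B = \<delta>"
    using A B le Aex commute lines_nonempty by (intro hausdorff_dist_eqI) (auto simp: \<delta>_def)
  then show ?thesis
    using le Aex by simp
qed

lemma hdist_le: "A \<in> lines \<Longrightarrow> B \<in> lines \<Longrightarrow> x \<in> A \<Longrightarrow> y \<in> B \<Longrightarrow> hdist A B \<le> d x y"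
  using hdist_lines by blast

lemma hdist_attained:
  assumes "A \<in> lines" "B \<in> lines" "x \<in> A"
  obtains y where "y \<in> B" "d x y = hdist A B"
  using hdist_lines assms by blast

lemma hdist_nonneg: "0 \<le> hdist A B"
  by (simp add: hausdorff_dist_def)

lemma hdist_zero:
  assumes A: "A \<in> lines" and B: "B \<in> lines" and z: "hdist A B = 0"
  shows "A \<subseteq> B"
proof
  fix x assume x: "x \<in> A"
  then obtain y where "y \<in> B" "d x y = 0"
    using hdist_attained[OF A B] z by metis
  then show "x \<in> B"
    using lines_in A B x by (metis zero)
qed

lemma hdist_commute: "hdist A B = hdist B A"
  by (simp add: hausdorff_dist_def max.commute)

lemma Metric_space_lines: "Metric_space lines hdist"
proof
  show "hdist A B = 0 \<longleftrightarrow> A = B" if AB: "A \<in> lines" "B \<in> lines" for A B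
  proof
    assume "hdist A B = 0"
    then show "A = B"
      using hdist_zero[of A B] hdist_zero[of B A] hdist_commute AB by auto
  next
    assume "A = B"
    then obtain x where "x \<in> A" "x \<in> B"
      using lines_nonempty AB by auto
    then show "hdist A B = 0"
      using hdist_le[OF AB, of x x] lines_in[of A x] AB hdist_nonneg[of A B] by simp
  qed
  show "hdist A C \<le> hdist A B + hdist B C" if ABC: "A \<in> lines" "B \<in> lines" "C \<in> lines" for A B C
  proof -
    obtain x where x: "x \<in> A"
      using lines_nonempty ABC by blast
    obtain y where y: "y \<in> B" "d x y = hdist A B"
      using hdist_attained ABC x by metis
    obtain z where z: "z \<in> C" "d y z = hdist B C"
      using hdist_attained ABC y by metis
    show ?thesis
      using hdist_le[OF ABC(1,3) x z(1)] triangle[of x y z] lines_in ABC x y z by fastforce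
  qed
qed (fact hdist_nonneg hdist_commute)+

sublocale L: Metric_space lines hdist
  by (fact Metric_space_lines)

text \<open>A common point forces Hausdorff distance 0. Thus the lines partition the parallel
  set.\<close>

lemma lines_disjoint:
  assumes "A \<in> lines" "B \<in> lines" "x \<in> A" "x \<in> B"
  shows "A = B"
proof -
  have "hdist A B = 0"
    using hdist_le[of A B x x] assms lines_in[of A x] hdist_nonneg[of A B] by simp
  then show ?thesis
    using assms by simp
qed

text \<open>A single line \<open>C\<close> serves all pairs of points on \<open>A\<close> and
  \<open>B\<close>, not only those with equal parameters: by \<open>segpt_oblique\<close> and
  uniqueness every division point lies on \<open>m\<close>.\<close>

lemma ex_line_segpt:
  assumes A: "A \<in> lines" and B: "B \<in> lines" and v: "0 \<le> v" "v \<le> 1"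
  obtains C where "C \<in> lines" "\<And>x y z. x \<in> A \<Longrightarrow> y \<in> B \<Longrightarrow> segpt v x y z \<Longrightarrow> z \<in> C"
proof -
  obtain \<gamma> where \<gamma>: "line \<gamma>" "parallel d \<gamma> \<omega>" "A = range \<gamma>"
    using A by (auto simp: parallel_lines_def)
  obtain \<eta> where \<eta>: "line \<eta>" "parallel d \<eta> \<omega>" "B = range \<eta>"
    using B by (auto simp: parallel_lines_def)
  have par: "parallel d \<gamma> \<eta>"
    using \<gamma> \<eta> line_\<omega> parallel_sym parallel_trans by blast
  have "\<exists>z. segpt v (\<gamma> t) (\<eta> t) z" for t
    using ex_segpt[of "\<gamma> t" "\<eta> t" v] line_in \<gamma>(1) \<eta>(1) v by blast
  then obtain m where m: "\<And>t. segpt v (\<gamma> t) (\<eta> t) (m t)"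
    by metis
  have lm: "line m"
    using line_segpt[OF \<gamma>(1) \<eta>(1) par v m] .
  have "parallel d m \<omega>"
    using parallel_trans[OF lm \<gamma>(1) line_\<omega> parallel_segpt[OF \<gamma>(1) \<eta>(1) par v m] \<gamma>(2)] .
  with lm have "range m \<in> lines"
    by (auto simp: parallel_lines_def)
  moreover have "z \<in> range m" if x: "x \<in> A" and y: "y \<in> B" and z: "segpt v x y z" for x y z
  proof -
    obtain s t where st: "x = \<gamma> s" "y = \<eta> t"
      using x y \<gamma> \<eta> by auto
    have "z = m ((1 - v) * s + v * t)"
      using segpt_unique[OF _ _ v z] segpt_oblique[OF \<gamma>(1) \<eta>(1) par v m] st line_in \<gamma> \<eta> by blast
    then show ?thesis
      by simp
  qed
  ultimately show ?thesis
    using that by blast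
qed

section \<open>Convexity of the parallel set\<close>

lemma parallel_setI: "A \<in> lines \<Longrightarrow> x \<in> A \<Longrightarrow> x \<in> parallel_set X d \<omega>"
  by (auto simp: parallel_set_def)

lemma geodesically_convex_parallel_set: "geodesically_convex X d (parallel_set X d \<omega>)"
  unfolding geodesically_convex_def
proof (intro conjI allI impI subsetI)
  show "x \<in> X" if "x \<in> parallel_set X d \<omega>" for x
    using that lines_in by (auto simp: parallel_set_def)
  fix a b :: real and \<gamma> x
  assume ab: "a \<le> b" and \<gamma>: "geodesic X d {a..b} \<gamma>"
    and "\<gamma> a \<in> parallel_set X d \<omega>" "\<gamma> b \<in> parallel_set X d \<omega>" and "x \<in> \<gamma> ` {a..b}"
  then obtain A B t where A: "A \<in> lines" "\<gamma> a \<in> A" and B: "B \<in> lines" "\<gamma> b \<in> B"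
    and t: "x = \<gamma> t" "a \<le> t" "t \<le> b"
    by (auto simp: parallel_set_def)
  have "closed_segment a b = {a..b}"
    using ab by (simp add: closed_segment_eq_real_ivl)
  then have "t \<in> closed_segment a b"
    using t by simp
  then obtain v where v: "0 \<le> v" "v \<le> 1" "t = (1 - v) * a + v * b"
    by (auto simp: closed_segment_def)
  obtain C where C: "C \<in> lines" "\<And>x y z. x \<in> A \<Longrightarrow> y \<in> B \<Longrightarrow> segpt v x y z \<Longrightarrow> z \<in> C"
    using ex_line_segpt[OF A(1) B(1) v(1,2)] by blast
  have "segpt v (\<gamma> a) (\<gamma> b) x"
    using geodesic_segment_point[OF \<gamma>, of a b v] ab v t by simp
  then show "x \<in> parallel_set X d \<omega>"
    using C A B parallel_setI by blast
qed

section \<open>The Busemann property of the space of lines\<close>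

definition line_through :: "'a \<Rightarrow> 'a set" where
  "line_through x = (THE A. A \<in> lines \<and> x \<in> A)"

lemma line_through_eq: "A \<in> lines \<Longrightarrow> x \<in> A \<Longrightarrow> line_through x = A"
  unfolding line_through_def by (rule the_equality) (auto dest: lines_disjoint)

lemma line_through:
  assumes "x \<in> parallel_set X d \<omega>"
  shows "line_through x \<in> lines" "x \<in> line_through x"
proof -
  obtain A where "A \<in> lines" "x \<in> A"
    using assms by (auto simp: parallel_set_def)
  then show "line_through x \<in> lines" "x \<in> line_through x"
    using line_through_eq by auto
qed

lemma hdist_line_through_le:
  assumes "x \<in> parallel_set X d \<omega>" "y \<in> parallel_set X d \<omega>"
  shows "hdist (line_through x) (line_through y) \<le> d x y"
  using assms hdist_le line_through by blast

text \<open>A geodesic of \<open>X\<close> between nearest points of the two lines stays in the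
  parallel set. Passing to the lines through its points does not increase distances, and it
  preserves the distance of the ends.\<close>

lemma geodesic_space_lines: "geodesic_space lines hdist"
  unfolding geodesic_space_def
proof (intro conjI ballI)
  fix A B assume A: "A \<in> lines" and B: "B \<in> lines"
  obtain x where x: "x \<in> A"
    using lines_nonempty A by blast
  obtain y where y: "y \<in> B" "d x y = hdist A B"
    using hdist_attained[OF A B x] .
  obtain \<sigma> where \<sigma>: "geodesic X d {0..d x y} \<sigma>" "\<sigma> 0 = x" "\<sigma> (d x y) = y"
    using ex_geodesic x y A B lines_in by blast
  have inP: "\<sigma> t \<in> parallel_set X d \<omega>" if "t \<in> {0..d x y}" for t
  proof -
    have "\<sigma> 0 \<in> parallel_set X d \<omega>" "\<sigma> (d x y) \<in> parallel_set X d \<omega>"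
      using parallel_setI A B x y \<sigma> by auto
    then have "\<sigma> ` {0..d x y} \<subseteq> parallel_set X d \<omega>"
      using geodesically_convex_parallel_set \<sigma>(1) nonneg[of x y]
      unfolding geodesically_convex_def by blast
    then show ?thesis
      using that by blast
  qed
  define G where "G t = line_through (\<sigma> t)" for t
  have G: "G t \<in> lines" if "t \<in> {0..d x y}" for t
    using line_through inP that by (simp add: G_def)
  have ends: "G 0 = A" "G (d x y) = B"
    using line_through_eq A B x y \<sigma> by (auto simp: G_def)
  have le: "hdist (G s) (G t) \<le> \<bar>t - s\<bar>" if "s \<in> {0..d x y}" "t \<in> {0..d x y}" for s t
    using hdist_line_through_le[OF inP inP] geodesic_dist[OF \<sigma>(1)] that by (simp add: G_def)
  \<comment> \<open>The upper bounds \<open>s\<close>, \<open>t - s\<close> and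
    \<open>d x y - t\<close> for the three pieces add up to \<open>hdist A B\<close>, so each of
    them is attained.\<close>
  have ge: "hdist (G s) (G t) = t - s" if st: "s \<in> {0..d x y}" "t \<in> {0..d x y}" "s \<le> t" for s t
    using L.triangle[of A "G s" B] L.triangle[of "G s" "G t" B]
      G[of s] G[of t] st A B ends y le[of 0 s] le[of s t] le[of t "d x y"] by auto
  have "geodesic lines hdist {0..d x y} G"
    unfolding geodesic_def
  proof (intro conjI ballI)
    show "hdist (G s) (G t) = \<bar>t - s\<bar>" if "s \<in> {0..d x y}" "t \<in> {0..d x y}" for s t
      using ge[of s t] ge[of t s] that hdist_commute[of "G s" "G t"] by (cases "s \<le> t") auto
  qed (use G in \<open>auto simp: is_interval_cc\<close>)
  then show "\<exists>a b \<gamma>. a \<le> b \<and> geodesic lines hdist {a..b} \<gamma> \<and> \<gamma> a = A \<and> \<gamma> b = B"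
    using ends by (intro exI[of _ 0] exI[of _ "d x y"] exI[of _ G]) simp
qed (fact Metric_space_lines)

text \<open>
  Lifting a division point of two lines to a division point of two of their points shows that
  it is the line given by \<open>ex_line_segpt\<close>, hence does not depend on the choice of these points.
\<close>
lemma segment_point_lines:
  assumes A: "A \<in> lines" and B: "B \<in> lines" and v: "0 \<le> v" "v \<le> 1"
    and C: "segment_point lines hdist v A B C"
    and x: "x \<in> A" and y: "y \<in> B" and z: "segpt v x y z"
  shows "z \<in> C"
proof -
  have CL: "C \<in> lines" and AC: "hdist A C = v * hdist A B" and CB: "hdist C B = (1 - v) * hdist A B"
    using C by (auto simp: segment_point_def)
  \<comment> \<open>Moving from \<open>x\<close> to a nearest \<open>c\<close> on \<open>C\<close>
    and on to a nearest \<open>b\<close> on \<open>B\<close> costs \<open>hdist A B\<close> in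
    total, which is at most \<open>d x b\<close>. So \<open>c\<close> divides the segment from
    \<open>x\<close> to \<open>b\<close>, and this common point identifies \<open>C\<close> with the
    line \<open>D\<close> below.\<close>
  obtain c where c: "c \<in> C" "d x c = hdist A C"
    using hdist_attained[OF A CL x] .
  obtain b where b: "b \<in> B" "d c b = hdist C B"
    using hdist_attained[OF CL B c(1)] .
  have "hdist A B \<le> d x b"
    using hdist_le A B x b by blast
  then have "v * hdist A B \<le> v * d x b" "(1 - v) * hdist A B \<le> (1 - v) * d x b"
    using v by (simp_all add: mult_left_mono)
  then have xbc: "segpt v x b c"
    using c b AC CB by (intro segptI lines_in[OF A x] lines_in[OF B] lines_in[OF CL]) auto
  obtain D where D: "D \<in> lines" "\<And>x y z. x \<in> A \<Longrightarrow> y \<in> B \<Longrightarrow> segpt v x y z \<Longrightarrow> z \<in> D"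
    using ex_line_segpt[OF A B v] by blast
  have "C = D"
    using lines_disjoint[OF CL D(1) c(1) D(2)[OF x b(1) xbc]] .
  then show ?thesis
    using D(2)[OF x y z] by simp
qed

text \<open>By \<open>segment_point_lines\<close> the points on the lines may be chosen freely.
  Taking \<open>a'\<close> nearest to \<open>a\<close> and, independently, \<open>b'\<close> nearest
  to \<open>b\<close> turns the convexity inequality of \<open>X\<close> into the one for
  lines.\<close>

lemma Busemann_space_lines: "Busemann_space lines hdist"
proof (rule Busemann_spaceI[OF geodesic_space_lines])
  fix v :: real and A B C A' B' C'
  assume v: "0 \<le> v" "v \<le> 1" and AB: "A \<in> lines" "B \<in> lines" "A' \<in> lines" "B' \<in> lines"
    and C: "segment_point lines hdist v A B C" and C': "segment_point lines hdist v A' B' C'"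
  obtain a where a: "a \<in> A"
    using AB lines_nonempty by blast
  obtain a' where a': "a' \<in> A'" "d a a' = hdist A A'"
    using hdist_attained AB a by metis
  obtain b where b: "b \<in> B"
    using AB lines_nonempty by blast
  obtain b' where b': "b' \<in> B'" "d b b' = hdist B B'"
    using hdist_attained AB b by metis
  obtain c where c: "segpt v a b c"
    using ex_segpt lines_in AB a b v by metis
  obtain c' where c': "segpt v a' b' c'"
    using ex_segpt lines_in AB a' b' v by metis
  have "c \<in> C" "c' \<in> C'"
    using segment_point_lines C C' AB v a a' b b' c c' by blast+
  moreover have "C \<in> lines" "C' \<in> lines"
    using C C' by (auto simp: segment_point_def)
  ultimately have "hdist C C' \<le> d c c'"
    using hdist_le by blast
  also have "\<dots> \<le> (1 - v) * d a a' + v * d b b'"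
    using segpt_dist_le v c c' lines_in AB a a' b b' by metis
  finally show "hdist C C' \<le> (1 - v) * hdist A A' + v * hdist B B'"
    using a' b' by simp
qed

section \<open>The Busemann function and the product decomposition\<close>

text \<open>The Busemann function of the backward ray of \<open>\<omega>\<close>. The expression is
  nonincreasing in \<open>T\<close>, so the infimum is the usual limit; the sign makes the function
  increase along \<open>\<omega>\<close>.\<close>

definition busemann_fun :: "'a \<Rightarrow> real" where
  "busemann_fun x = (INF T. d (\<omega> (- T)) x - T)"

lemma busemann_fun_le:
  assumes x: "x \<in> X"
  shows "busemann_fun x \<le> d (\<omega> (- T)) x - T"
  unfolding busemann_fun_def
proof (rule cINF_lower)
  show "bdd_below (range (\<lambda>T. d (\<omega> (- T)) x - T))"
  proof (rule bdd_belowI2)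
    fix T show "- d (\<omega> 0) x \<le> d (\<omega> (- T)) x - T"
      using triangle[of "\<omega> (- T)" x "\<omega> 0"] line_in[OF line_\<omega>] line_dist[OF line_\<omega>, of "- T" 0] x
        commute[of x "\<omega> 0"]
      by simp
  qed
qed simp

lemma busemann_fun_greatest: "(\<And>T. c \<le> d (\<omega> (- T)) x - T) \<Longrightarrow> c \<le> busemann_fun x"
  unfolding busemann_fun_def by (rule cINF_greatest) auto

lemma busemann_fun_nonexpansive:
  assumes x: "x \<in> X" and y: "y \<in> X"
  shows "\<bar>busemann_fun x - busemann_fun y\<bar> \<le> d x y"
proof -
  have "busemann_fun p - d p q \<le> busemann_fun q" if "p \<in> X" "q \<in> X" for p q
  proof (rule busemann_fun_greatest)
    show "busemann_fun p - d p q \<le> d (\<omega> (- T)) q - T" for T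
      using busemann_fun_le[OF that(1), of T] triangle[of "\<omega> (- T)" q p] line_in[OF line_\<omega>] that
        commute[of p q]
      by (smt (verit))
  qed
  from this[OF x y] this[OF y x] show ?thesis
    by (simp add: commute)
qed

text \<open>The distance from \<open>\<omega> (- T)\<close> to \<open>\<gamma> a\<close> depends
  only on \<open>T + a\<close>, so moving along \<open>\<gamma>\<close> amounts to substituting a
  shifted \<open>T\<close> in the infimum. Exchanging the two points gives the reverse
  inequality.\<close>

lemma busemann_fun_line:
  assumes \<gamma>: "line \<gamma>" and par: "parallel d \<gamma> \<omega>"
  shows "busemann_fun (\<gamma> t) = busemann_fun (\<gamma> s) + (t - s)"
proof -
  have "busemann_fun (\<gamma> b) - (b - a) \<le> busemann_fun (\<gamma> a)" for a b
  proof (rule busemann_fun_greatest)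
    fix T
    have "d (\<omega> (- T)) (\<gamma> a) = d (\<omega> (- (T - (b - a)))) (\<gamma> b)"
      using parallel_dist[OF line_\<omega> \<gamma> parallel_sym[OF par], of "- T" a]
        parallel_dist[OF line_\<omega> \<gamma> parallel_sym[OF par], of "- (T - (b - a))" b]
      by (simp add: algebra_simps)
    then show "busemann_fun (\<gamma> b) - (b - a) \<le> d (\<omega> (- T)) (\<gamma> a) - T"
      using busemann_fun_le[OF line_in[OF \<gamma>], of b "T - (b - a)"] by simp
  qed
  from this[of t s] this[of s t] show ?thesis
    by simp
qed

lemma dist_eq_busemann_fun:
  assumes A: "A \<in> lines" and x: "x \<in> A" and y: "y \<in> A"
  shows "d x y = \<bar>busemann_fun x - busemann_fun y\<bar>"
proof -
  obtain \<gamma> where \<gamma>: "line \<gamma>" "parallel d \<gamma> \<omega>" "A = range \<gamma>" "x = \<gamma> 0"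
    using linesE[OF A x] .
  then obtain t where t: "y = \<gamma> t"
    using y by auto
  show ?thesis
    using line_dist[OF \<gamma>(1), of 0 t] busemann_fun_line[OF \<gamma>(1,2), of t 0] t \<gamma>(4) by simp
qed

lemma ex1_busemann_fun_eq:
  assumes A: "A \<in> lines"
  shows "\<exists>!x. x \<in> A \<and> busemann_fun x = r"
proof -
  obtain \<gamma> where \<gamma>: "line \<gamma>" "parallel d \<gamma> \<omega>" "A = range \<gamma>"
    using A by (auto simp: parallel_lines_def)
  have "busemann_fun (\<gamma> (r - busemann_fun (\<gamma> 0))) = r"
    using busemann_fun_line[OF \<gamma>(1,2), of "r - busemann_fun (\<gamma> 0)" 0] by simp
  then have "\<exists>x. x \<in> A \<and> busemann_fun x = r"
    using \<gamma> by blast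
  moreover have "x = y" if "x \<in> A" "y \<in> A" "busemann_fun x = r" "busemann_fun y = r" for x y
    using dist_eq_busemann_fun[OF A that(1,2)] lines_in[OF A] that by simp
  ultimately show ?thesis
    by blast
qed

definition line_point :: "'a set \<times> real \<Rightarrow> 'a" where
  "line_point = (\<lambda>(A, r). THE x. x \<in> A \<and> busemann_fun x = r)"

lemma line_point:
  assumes "A \<in> lines"
  shows "line_point (A, r) \<in> A" "busemann_fun (line_point (A, r)) = r"
  using theI'[OF ex1_busemann_fun_eq[OF assms, of r]] by (simp_all add: line_point_def)

lemma line_point_eq:
  assumes "A \<in> lines" "x \<in> A"
  shows "line_point (A, busemann_fun x) = x"
  using ex1_busemann_fun_eq[OF assms(1)] line_point[OF assms(1)] assms(2) by blast

text \<open>Go from \<open>x\<close> to a nearest point \<open>z\<close> of \<open>B\<close>, then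
  along \<open>B\<close> to \<open>y\<close>. The factor 2 arises because the first move may also
  change the Busemann function by up to \<open>hdist A B\<close>.\<close>

lemma dist_le_hdist_busemann_fun:
  assumes A: "A \<in> lines" and B: "B \<in> lines" and x: "x \<in> A" and y: "y \<in> B"
  shows "d x y \<le> 2 * hdist A B + \<bar>busemann_fun x - busemann_fun y\<bar>"
proof -
  obtain z where z: "z \<in> B" "d x z = hdist A B"
    using hdist_attained[OF A B x] .
  have X: "x \<in> X" "y \<in> X" "z \<in> X"
    using lines_in A B x y z by auto
  have "d x y \<le> d x z + \<bar>busemann_fun z - busemann_fun y\<bar>"
    using triangle[of x z y] X dist_eq_busemann_fun[OF B z(1) y] by simp
  then show ?thesis
    using busemann_fun_nonexpansive[OF X(1,3)] z by linarith
qed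

text \<open>Continuity in both directions comes from Lipschitz bounds, with the product topology
  given by the product metric.\<close>

lemma homeomorphic_maps_parallel_set:
  "homeomorphic_maps (subtopology mtopology (parallel_set X d \<omega>))
     (prod_topology L.mtopology euclideanreal)
     (\<lambda>x. (line_through x, busemann_fun x)) line_point"
proof -
  define P where "P = parallel_set X d \<omega>"
  define m where "m = submetric (metric (X, d)) P"
  define n where "n = prod_metric (metric (lines, hdist)) (euclidean_metric :: real metric)"
  have PX: "P \<subseteq> X"
    using geodesically_convex_parallel_set by (simp add: geodesically_convex_def P_def)
  have m: "mspace m = P" "mdist m = d" "mtopology_of m = subtopology mtopology P"
    using PX by (auto simp: m_def mtopology_of_submetric)
  have n: "mspace n = lines \<times> UNIV" "mtopology_of n = prod_topology L.mtopology euclideanreal"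
    "mdist n = prod_dist hdist dist"
    by (auto simp: n_def)
  have lt: "line_through x \<in> lines" "x \<in> line_through x" if "x \<in> P" for x
    using that line_through by (auto simp: P_def)
  have "Lipschitz_continuous_map m (metric (lines, hdist)) line_through"
    unfolding Lipschitz_continuous_map_def
    by (auto simp: m P_def line_through intro!: exI[of _ 1] hdist_line_through_le)
  moreover have "Lipschitz_continuous_map m euclidean_metric busemann_fun"
    unfolding Lipschitz_continuous_map_def
    by (auto simp: m dist_real_def intro!: exI[of _ 1] busemann_fun_nonexpansive subsetD[OF PX])
  ultimately have f: "continuous_map (mtopology_of m) (mtopology_of n)
      (\<lambda>x. (line_through x, busemann_fun x))"
    unfolding n_def
    by (intro Lipschitz_continuous_imp_continuous_map) (simp add: Lipschitz_continuous_map_paired)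
  have lp: "line_point p \<in> P" if "p \<in> lines \<times> UNIV" for p
    using that line_point(1) parallel_setI by (auto simp: P_def)
  \<comment> \<open>The constant is 2 + 1: the product distance dominates the distance in each
    coordinate.\<close>
  have "d (line_point p) (line_point q) \<le> 3 * prod_dist hdist dist p q"
    if p: "p \<in> lines \<times> UNIV" and q: "q \<in> lines \<times> UNIV" for p q
  proof -
    obtain A r B s where e: "p = (A, r)" "q = (B, s)"
      by fastforce
    then have AB: "A \<in> lines" "B \<in> lines"
      using p q by auto
    have "d (line_point p) (line_point q) \<le> 2 * hdist A B + dist r s"
      using dist_le_hdist_busemann_fun[OF AB line_point(1)[OF AB(1), of r] line_point(1)[OF AB(2), of s]]
      by (simp add: e line_point(2) AB dist_real_def)
    moreover have "hdist A B \<le> prod_dist hdist dist p q" "dist r s \<le> prod_dist hdist dist p q"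
      by (simp_all add: e prod_dist_def)
    ultimately show ?thesis
      by linarith
  qed
  then have "Lipschitz_continuous_map n m line_point"
    unfolding Lipschitz_continuous_map_def using lp by (auto simp: m n intro!: exI[of _ 3])
  then have "continuous_map (mtopology_of n) (mtopology_of m) line_point"
    by (rule Lipschitz_continuous_imp_continuous_map)
  with f have "homeomorphic_maps (mtopology_of m) (mtopology_of n)
      (\<lambda>x. (line_through x, busemann_fun x)) line_point"
    unfolding homeomorphic_maps_def
    using lt line_point line_point_eq line_through_eq by (auto simp: m n)
  then show ?thesis
    by (simp only: m n P_def)
qed

end

theorem theorem1p2:
  fixes X :: "'a set" and d :: "'a \<Rightarrow> 'a \<Rightarrow> real" and \<omega> :: "real \<Rightarrow> 'a"
  assumes "Busemann_space X d"
    and "geodesic X d UNIV \<omega>"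
  shows "geodesically_convex X d (parallel_set X d \<omega>)
    \<and> Busemann_space (parallel_lines X d \<omega>) (hausdorff_dist d)
    \<and> subtopology (Metric_space.mtopology X d) (parallel_set X d \<omega>)
        homeomorphic_space
      prod_topology
        (Metric_space.mtopology (parallel_lines X d \<omega>) (hausdorff_dist d))
        euclideanreal"
proof -
  have "Metric_space X d"
    using assms(1) by (simp add: Busemann_space_def geodesic_space_def)
  then interpret busemann_line X d \<omega>
    using assms by (simp add: busemann_line_def busemann_def busemann_axioms_def busemann_line_axioms_def)
  show ?thesis
    using geodesically_convex_parallel_set Busemann_space_lines homeomorphic_maps_parallel_set
    unfolding homeomorphic_space_def by blast
qed

end
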